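(* Let $\mathcal{C}$ be a category and let $F:\mathcal{C}\to\mathrm{Set}$ be a functor. Then $F$ is small if and only if there is a small category $\mathcal{J}$ and a cofinal functor $\mathcal{J}\to\mathcal{E}_F$, where $\mathcal{E}_F$ is the category of elements of $F$.
   Context: The category $\mathcal{C}$ is not required to be small. A functor $F:\mathcal{C}\to\mathrm{Set}$ is *small* if it is the (pointwise) colimit of a small diagram of representables, i.e. $F\simeq \operatorname{colim}_{J\in\mathcal{J}^{\mathrm{op}}}\mathrm{Hom}_{\mathcal{C}}(DJ,-)$ for some functor $D:\mathcal{J}\to\mathcal{C}$ with $\mathcal{J}$ small. The *category of elements* $\mathcal{E}_F$ has as objects the pairs $(A,x)$ with $A\in\mathcal{C}$ and $x\in FA$, and as morphisms $(A,x)\to(B,y)$ the morphisms $f:A\to B$ in $\mathcal{C}$ with $(Ff)(x)=y$. A functor $H:\mathcal{J}\to\mathcal{K}$ is *final* if for every object $K\in\mathcal{K}$ the colimit over $J\in\mathcal{J}$ of $\mathrm{Hom}_{\mathcal{K}}(K,HJ)$ is a one-point set (equivalently, the comma category $K\downarrow H$ is non-empty and connected). The dual notion is *cofinal*: $H$ is cofinal if for every $K\in\mathcal{K}$ the comma category $H\downarrow K$ (objects: pairs $(J,\,HJ\to K)$) is non-empty and connected. *)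

theory Defs
  imports "HOL-Library.FuncSet" "HOL-Library.Equipollence"
begin

text \<open>
  Size. The type \<open>'u\<close> plays the part of the universe in which sets have their elements: a set is
  small iff it has strictly fewer elements than \<open>'u\<close>. If the cardinality of \<open>'u\<close> is inaccessible,
  the small sets are, up to bijection, exactly the members of a Grothendieck universe, and every
  small category is isomorphic to one whose objects and arrows are elements of \<open>'u\<close>. Nothing here
  depends on inaccessibility, so it is not built into the definition.
\<close>

definition small :: "'u itself \<Rightarrow> 'a set \<Rightarrow> bool" where
  "small U X \<longleftrightarrow> X \<prec> (UNIV :: 'u set)"

text \<open>
  Hom-sets need not be disjoint, so composition and identities carry their objects as arguments:
  \<open>Comp C X Y Z g f\<close> is the composite of \<open>f : X \<rightarrow> Y\<close> and \<open>g : Y \<rightarrow> Z\<close>. In this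
  way a category with arrows in \<open>'a\<close> may have objects of an arbitrary type.
\<close>

record ('o, 'a) category =
  Obj :: "'o set"
  Hom :: "'o \<Rightarrow> 'o \<Rightarrow> 'a set"
  Comp :: "'o \<Rightarrow> 'o \<Rightarrow> 'o \<Rightarrow> 'a \<Rightarrow> 'a \<Rightarrow> 'a"
  Id :: "'o \<Rightarrow> 'a"

definition is_category :: "('o, 'a) category \<Rightarrow> bool" where
  "is_category C \<longleftrightarrow>
    (\<forall>X\<in>Obj C. Id C X \<in> Hom C X X) \<and>
    (\<forall>X\<in>Obj C. \<forall>Y\<in>Obj C. \<forall>Z\<in>Obj C. \<forall>f\<in>Hom C X Y. \<forall>g\<in>Hom C Y Z.
       Comp C X Y Z g f \<in> Hom C X Z) \<and>
    (\<forall>X\<in>Obj C. \<forall>Y\<in>Obj C. \<forall>f\<in>Hom C X Y.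
       Comp C X X Y f (Id C X) = f \<and> Comp C X Y Y (Id C Y) f = f) \<and>
    (\<forall>W\<in>Obj C. \<forall>X\<in>Obj C. \<forall>Y\<in>Obj C. \<forall>Z\<in>Obj C.
       \<forall>f\<in>Hom C W X. \<forall>g\<in>Hom C X Y. \<forall>h\<in>Hom C Y Z.
       Comp C W X Z (Comp C X Y Z h g) f = Comp C W Y Z h (Comp C W X Y g f))"

definition Arr :: "('o, 'a) category \<Rightarrow> ('o \<times> 'o \<times> 'a) set" where
  "Arr C = {(X, Y, f). X \<in> Obj C \<and> Y \<in> Obj C \<and> f \<in> Hom C X Y}"

definition small_category :: "'u itself \<Rightarrow> ('o, 'a) category \<Rightarrow> bool" where
  "small_category U J \<longleftrightarrow> is_category J \<and> small U (Obj J) \<and> small U (Arr J)"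

definition locally_small :: "'u itself \<Rightarrow> ('o, 'a) category \<Rightarrow> bool" where
  "locally_small U C \<longleftrightarrow> (\<forall>X\<in>Obj C. \<forall>Y\<in>Obj C. small U (Hom C X Y))"

definition op_cat :: "('o, 'a) category \<Rightarrow> ('o, 'a) category" where
  "op_cat C = \<lparr>Obj = Obj C, Hom = (\<lambda>X Y. Hom C Y X),
     Comp = (\<lambda>X Y Z g f. Comp C Z Y X f g), Id = Id C\<rparr>"

definition SET :: "('u set, 'u \<Rightarrow> 'u) category" where
  "SET = \<lparr>Obj = {X. small TYPE('u) X}, Hom = (\<lambda>X Y. X \<rightarrow>\<^sub>E Y),
     Comp = (\<lambda>X Y Z g f. compose X g f), Id = (\<lambda>X. \<lambda>x\<in>X. x)\<rparr>"

record ('o, 'a, 'p, 'b) cfunctor =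
  fobj :: "'o \<Rightarrow> 'p"
  farr :: "'o \<Rightarrow> 'o \<Rightarrow> 'a \<Rightarrow> 'b"

definition is_functor ::
  "('o, 'a) category \<Rightarrow> ('p, 'b) category \<Rightarrow> ('o, 'a, 'p, 'b) cfunctor \<Rightarrow> bool" where
  "is_functor C D F \<longleftrightarrow>
    (\<forall>X\<in>Obj C. fobj F X \<in> Obj D) \<and>
    (\<forall>X\<in>Obj C. \<forall>Y\<in>Obj C. \<forall>f\<in>Hom C X Y. farr F X Y f \<in> Hom D (fobj F X) (fobj F Y)) \<and>
    (\<forall>X\<in>Obj C. farr F X X (Id C X) = Id D (fobj F X)) \<and>
    (\<forall>X\<in>Obj C. \<forall>Y\<in>Obj C. \<forall>Z\<in>Obj C. \<forall>f\<in>Hom C X Y. \<forall>g\<in>Hom C Y Z.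
       farr F X Z (Comp C X Y Z g f) =
         Comp D (fobj F X) (fobj F Y) (fobj F Z) (farr F Y Z g) (farr F X Y f))"

definition is_nat_trans :: "('o, 'a) category \<Rightarrow> ('p, 'b) category \<Rightarrow>
    ('o, 'a, 'p, 'b) cfunctor \<Rightarrow> ('o, 'a, 'p, 'b) cfunctor \<Rightarrow> ('o \<Rightarrow> 'b) \<Rightarrow> bool" where
  "is_nat_trans C D F G t \<longleftrightarrow>
    (\<forall>X\<in>Obj C. t X \<in> Hom D (fobj F X) (fobj G X)) \<and>
    (\<forall>X\<in>Obj C. \<forall>Y\<in>Obj C. \<forall>f\<in>Hom C X Y.
       Comp D (fobj F X) (fobj F Y) (fobj G Y) (t Y) (farr F X Y f) =
       Comp D (fobj F X) (fobj G X) (fobj G Y) (farr G X Y f) (t X))"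

text \<open>The representable functor \<open>Hom(A, -)\<close>.\<close>

definition hom_functor :: "('o, 'u) category \<Rightarrow> 'o \<Rightarrow> ('o, 'u, 'u set, 'u \<Rightarrow> 'u) cfunctor" where
  "hom_functor C A = \<lparr>fobj = (\<lambda>X. Hom C A X),
     farr = (\<lambda>X Y g. \<lambda>f\<in>Hom C A X. Comp C A X Y g f)\<rparr>"

definition is_cocone :: "('i, 'j) category \<Rightarrow> ('p, 'b) category \<Rightarrow>
    ('i, 'j, 'p, 'b) cfunctor \<Rightarrow> 'p \<Rightarrow> ('i \<Rightarrow> 'b) \<Rightarrow> bool" where
  "is_cocone I K G M c \<longleftrightarrow> M \<in> Obj K \<and>
    (\<forall>i\<in>Obj I. c i \<in> Hom K (fobj G i) M) \<and>
    (\<forall>i\<in>Obj I. \<forall>j\<in>Obj I. \<forall>u\<in>Hom I i j.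
       Comp K (fobj G i) (fobj G j) M (c j) (farr G i j u) = c i)"

definition is_colimit :: "('i, 'j) category \<Rightarrow> ('p, 'b) category \<Rightarrow>
    ('i, 'j, 'p, 'b) cfunctor \<Rightarrow> 'p \<Rightarrow> ('i \<Rightarrow> 'b) \<Rightarrow> bool" where
  "is_colimit I K G L c \<longleftrightarrow> is_cocone I K G L c \<and>
    (\<forall>M d. is_cocone I K G M d \<longrightarrow>
       (\<exists>!h. h \<in> Hom K L M \<and> (\<forall>i\<in>Obj I. Comp K (fobj G i) L M h (c i) = d i)))"

text \<open>
  For \<open>D : J \<rightarrow> C\<close>, the diagram \<open>J\<^sup>o\<^sup>p \<rightarrow> Set\<close>, \<open>j \<mapsto> Hom(D j, A)\<close>. An arrow \<open>u : i \<rightarrow> j\<close> of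
  \<open>J\<^sup>o\<^sup>p\<close>, that is \<open>u : j \<rightarrow> i\<close> in \<open>J\<close>, acts by precomposition with \<open>D u : D j \<rightarrow> D i\<close>.
\<close>

definition rep_diagram :: "('o, 'u) category \<Rightarrow> ('i, 'j, 'o, 'u) cfunctor \<Rightarrow> 'o \<Rightarrow>
    ('i, 'j, 'u set, 'u \<Rightarrow> 'u) cfunctor" where
  "rep_diagram C D A = \<lparr>fobj = (\<lambda>j. Hom C (fobj D j) A),
     farr = (\<lambda>i j u. \<lambda>f\<in>Hom C (fobj D i) A. Comp C (fobj D j) (fobj D i) A f (farr D j i u))\<rparr>"

text \<open>
  \<open>F\<close> is a pointwise colimit of \<open>j \<mapsto> Hom(D j, -)\<close> over \<open>J\<^sup>o\<^sup>p\<close>, with coprojections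
  \<open>c j : Hom(D j, -) \<Rightarrow> F\<close>.
\<close>

definition is_pointwise_colimit_of_reps :: "('i, 'j) category \<Rightarrow> ('o, 'u) category \<Rightarrow>
    ('i, 'j, 'o, 'u) cfunctor \<Rightarrow> ('o, 'u, 'u set, 'u \<Rightarrow> 'u) cfunctor \<Rightarrow>
    ('i \<Rightarrow> 'o \<Rightarrow> 'u \<Rightarrow> 'u) \<Rightarrow> bool" where
  "is_pointwise_colimit_of_reps J C D F c \<longleftrightarrow>
    (\<forall>j\<in>Obj J. is_nat_trans C SET (hom_functor C (fobj D j)) F (c j)) \<and>
    (\<forall>A\<in>Obj C. is_colimit (op_cat J) SET (rep_diagram C D A) (fobj F A) (\<lambda>j. c j A))"

definition small_functor ::
  "('o, 'u) category \<Rightarrow> ('o, 'u, 'u set, 'u \<Rightarrow> 'u) cfunctor \<Rightarrow> bool" where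
  "small_functor C F \<longleftrightarrow>
    (\<exists>(J :: ('u, 'u) category) D c. small_category TYPE('u) J \<and> is_functor J C D \<and>
       is_pointwise_colimit_of_reps J C D F c)"

definition elements_cat :: "('o, 'u) category \<Rightarrow> ('o, 'u, 'u set, 'u \<Rightarrow> 'u) cfunctor \<Rightarrow>
    ('o \<times> 'u, 'u) category" where
  "elements_cat C F = \<lparr>Obj = {(A, x). A \<in> Obj C \<and> x \<in> fobj F A},
     Hom = (\<lambda>(A, x) (B, y). {f \<in> Hom C A B. farr F A B f x = y}),
     Comp = (\<lambda>p q r g f. Comp C (fst p) (fst q) (fst r) g f),
     Id = (\<lambda>p. Id C (fst p))\<rparr>"

text \<open>The comma category \<open>H \<down> K\<close> for a functor \<open>H : J \<rightarrow> D\<close> and an object \<open>K\<close> of \<open>D\<close>.\<close>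

definition comma_cat :: "('i, 'j) category \<Rightarrow> ('p, 'b) category \<Rightarrow>
    ('i, 'j, 'p, 'b) cfunctor \<Rightarrow> 'p \<Rightarrow> ('i \<times> 'b, 'j) category" where
  "comma_cat J D H K = \<lparr>Obj = {(i, a). i \<in> Obj J \<and> a \<in> Hom D (fobj H i) K},
     Hom = (\<lambda>(i, a) (j, b). {u \<in> Hom J i j. Comp D (fobj H i) (fobj H j) K b (farr H i j u) = a}),
     Comp = (\<lambda>p q r g f. Comp J (fst p) (fst q) (fst r) g f),
     Id = (\<lambda>p. Id J (fst p))\<rparr>"

text \<open>Any two objects are joined by a finite zigzag of arrows.\<close>

definition connected_cat :: "('o, 'a) category \<Rightarrow> bool" where
  "connected_cat C \<longleftrightarrow> (\<forall>X\<in>Obj C. \<forall>Y\<in>Obj C.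
     (X, Y) \<in> {(A, B). A \<in> Obj C \<and> B \<in> Obj C \<and> (Hom C A B \<noteq> {} \<or> Hom C B A \<noteq> {})}\<^sup>*)"

definition cofinal_functor :: "('i, 'j) category \<Rightarrow> ('p, 'b) category \<Rightarrow>
    ('i, 'j, 'p, 'b) cfunctor \<Rightarrow> bool" where
  "cofinal_functor J D H \<longleftrightarrow> is_functor J D H \<and>
    (\<forall>K\<in>Obj D. Obj (comma_cat J D H K) \<noteq> {} \<and> connected_cat (comma_cat J D H K))"

lemma is_category_op_cat: "is_category C \<Longrightarrow> is_category (op_cat C)"
  by (auto simp: is_category_def op_cat_def)

lemma is_category_SET: "is_category (SET :: ('u set, 'u \<Rightarrow> 'u) category)"
  unfolding is_category_def SET_def
  by (auto simp: compose_def PiE_iff restrict_def extensional_def fun_eq_iff)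

lemma is_functor_hom_functor:
  fixes C :: "('o, 'u) category"
  assumes "is_category C" "locally_small TYPE('u) C" "A \<in> Obj C"
  shows "is_functor C SET (hom_functor C A)"
  using assms
  by (auto simp: is_functor_def is_category_def SET_def hom_functor_def locally_small_def
      compose_def restrict_def PiE_iff extensional_def fun_eq_iff)

lemma is_functor_rep_diagram:
  fixes C :: "('o, 'u) category"
  assumes "is_category J" "is_category C" "locally_small TYPE('u) C" "is_functor J C D" "A \<in> Obj C"
  shows "is_functor (op_cat J) SET (rep_diagram C D A)"
  using assms
  by (auto simp: is_functor_def is_category_def SET_def op_cat_def rep_diagram_def locally_small_def
      compose_def restrict_def PiE_iff extensional_def fun_eq_iff)

lemma is_category_elements_cat:
  assumes "is_category C" "is_functor C SET F"
  shows "is_category (elements_cat C F)"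
  using assms
  by (auto simp: is_functor_def is_category_def SET_def elements_cat_def compose_def)

lemma is_category_comma_cat:
  assumes "is_category J" "is_category D" "is_functor J D H" "K \<in> Obj D"
  shows "is_category (comma_cat J D H K)"
  using assms
  by (auto simp: is_functor_def is_category_def comma_cat_def)
end

theory Submission
  imports Defs
begin

text \<open>
  By the Yoneda lemma, a cocone from a diagram of representables \<open>Hom(D j, -)\<close> to \<open>F\<close> is the same
  thing as a lift of \<open>D : J \<rightarrow> C\<close> to a functor \<open>H : J \<rightarrow> E\<^sub>F\<close> into the category of elements: the
  coprojection at \<open>j\<close> is determined by an element \<open>x \<in> F (D j)\<close>, and \<open>H j = (D j, x)\<close>
  (\<open>pointwise_colimit_lift\<close> goes one way and \<open>element_cocone\<close> the other). It remains to see that such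
  a cocone is a pointwise colimit exactly when \<open>H\<close> is cofinal, with the same \<open>J\<close> on both sides, so
  that smallness of \<open>J\<close> carries over unchanged.

  A cocone of sets is a colimit iff, for each point \<open>y\<close> of the vertex, the pairs \<open>(i, x)\<close> that are
  sent to \<open>y\<close> form a nonempty set which is connected by the arrows of the diagram
  (\<open>is_colimit_SET_iff_connected_fibres\<close>). For the diagram \<open>j \<mapsto> Hom(D j, A)\<close> and \<open>y \<in> F A\<close> these
  pairs are the objects of the comma category \<open>H \<down> (A, y)\<close>, and the arrows that connect them are
  its arrows; letting \<open>A\<close> and \<open>y\<close> vary gives \<open>pointwise_colimit_iff_cofinal\<close>.
\<close>

section \<open>Colimits of sets and connected fibres\<close>

lemma is_cocone_SET_iff:
  "is_cocone I SET G M d \<longleftrightarrow>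
    small TYPE('u) (M :: 'u set) \<and> (\<forall>i\<in>Obj I. d i \<in> fobj G i \<rightarrow>\<^sub>E M) \<and>
    (\<forall>i\<in>Obj I. \<forall>j\<in>Obj I. \<forall>u\<in>Hom I i j. \<forall>x\<in>fobj G i. d j (farr G i j u x) = d i x)"
proof -
  have "compose (fobj G i) (d j) (farr G i j u) = d i \<longleftrightarrow>
      (\<forall>x\<in>fobj G i. d j (farr G i j u x) = d i x)"
    if "d i \<in> fobj G i \<rightarrow>\<^sub>E M" for i j u
    using that by (auto simp: compose_def fun_eq_iff restrict_def PiE_iff extensional_def)
  then show ?thesis
    by (auto simp: is_cocone_def SET_def)
qed

lemma is_colimit_SET_iff:
  "is_colimit I SET G L c \<longleftrightarrow> is_cocone I SET G L c \<and>
    (\<forall>M d. is_cocone I SET G (M :: 'u set) d \<longrightarrow>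
      (\<exists>!h. h \<in> L \<rightarrow>\<^sub>E M \<and> (\<forall>i\<in>Obj I. \<forall>x\<in>fobj G i. h (c i x) = d i x)))"
proof -
  have "compose (fobj G i) h (c i) = d i \<longleftrightarrow> (\<forall>x\<in>fobj G i. h (c i x) = d i x)"
    if "is_cocone I SET G M d" "i \<in> Obj I" for M :: "'u set" and d h i
  proof -
    have "d i \<in> extensional (fobj G i)"
      using that unfolding is_cocone_SET_iff by (auto simp: PiE_iff)
    then show ?thesis
      by (auto simp: compose_def fun_eq_iff restrict_def extensional_def)
  qed
  moreover have "Hom SET L M = (L \<rightarrow>\<^sub>E M)" "Comp SET X L M h f = compose X h f"
    for M X :: "'u set" and h f
    by (simp_all add: SET_def)
  ultimately show ?thesis
    unfolding is_colimit_def by (simp cong: conj_cong imp_cong)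
qed

text \<open>
  Two distinct elements of \<open>'u\<close> serve as truth values, so predicates on the colimit vertex \<open>L\<close>
  are the compatible families of predicates on the terms of the diagram. Testing against this
  two-element set is enough to detect the points and the identifications of the colimit, without
  constructing any quotient.
\<close>

lemma colimit_SET_predicate:
  fixes L :: "'u set"
  assumes inf: "infinite (UNIV :: 'u set)"
    and colim: "is_colimit I SET G L c"
    and P: "\<And>i j u x. \<lbrakk>i \<in> Obj I; j \<in> Obj I; u \<in> Hom I i j; x \<in> fobj G i\<rbrakk>
      \<Longrightarrow> P j (farr G i j u x) \<longleftrightarrow> P i x"
    and G: "\<And>i j u x. \<lbrakk>i \<in> Obj I; j \<in> Obj I; u \<in> Hom I i j; x \<in> fobj G i\<rbrakk>
      \<Longrightarrow> farr G i j u x \<in> fobj G j"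
  shows "\<exists>!S. S \<subseteq> L \<and> (\<forall>i\<in>Obj I. \<forall>x\<in>fobj G i. c i x \<in> S \<longleftrightarrow> P i x)"
proof -
  obtain t f :: 'u where tf: "t \<noteq> f"
    using inf by (metis (full_types) UNIV_eq_I finite.simps singletonI)
  define d where "d = (\<lambda>i. \<lambda>x\<in>fobj G i. if P i x then t else f)"
  have "small TYPE('u) {t, f}"
    using inf by (simp add: small_def finite_lesspoll_infinite)
  then have "is_cocone I SET G {t, f} d"
    using P G by (auto simp: is_cocone_SET_iff d_def)
  then have ex1: "\<exists>!h. h \<in> L \<rightarrow>\<^sub>E {t, f} \<and> (\<forall>i\<in>Obj I. \<forall>x\<in>fobj G i. h (c i x) = d i x)"
    using colim by (auto simp: is_colimit_SET_iff)
  have c: "c i x \<in> L" if "i \<in> Obj I" "x \<in> fobj G i" for i x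
    using colim that unfolding is_colimit_SET_iff is_cocone_SET_iff by blast
  define \<chi> where "\<chi> = (\<lambda>S. \<lambda>z\<in>L. if z \<in> S then t else f)"
  have \<chi>: "\<chi> S \<in> L \<rightarrow>\<^sub>E {t, f} \<and> (\<forall>i\<in>Obj I. \<forall>x\<in>fobj G i. \<chi> S (c i x) = d i x)"
    if "S \<subseteq> L" "\<forall>i\<in>Obj I. \<forall>x\<in>fobj G i. c i x \<in> S \<longleftrightarrow> P i x" for S
    using that c by (auto simp: \<chi>_def d_def)
  show ?thesis
  proof (rule ex_ex1I)
    obtain h where h: "\<forall>i\<in>Obj I. \<forall>x\<in>fobj G i. h (c i x) = d i x"
      using ex1 by blast
    show "\<exists>S. S \<subseteq> L \<and> (\<forall>i\<in>Obj I. \<forall>x\<in>fobj G i. c i x \<in> S \<longleftrightarrow> P i x)"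
      using h c tf by (intro exI[of _ "{z \<in> L. h z = t}"]) (auto simp: d_def)
  next
    fix S S'
    assume S: "S \<subseteq> L \<and> (\<forall>i\<in>Obj I. \<forall>x\<in>fobj G i. c i x \<in> S \<longleftrightarrow> P i x)"
      and S': "S' \<subseteq> L \<and> (\<forall>i\<in>Obj I. \<forall>x\<in>fobj G i. c i x \<in> S' \<longleftrightarrow> P i x)"
    have "\<chi> S = \<chi> S'"
      using ex1 \<chi>[of S] \<chi>[of S'] S S' by blast
    then have "z \<in> S \<longleftrightarrow> z \<in> S'" if "z \<in> L" for z
      using that tf by (auto simp: \<chi>_def fun_eq_iff split: if_splits)
    then show "S = S'"
      using S S' by blast
  qed
qed

definition cocone_fibre ::
  "('i, 'j) category \<Rightarrow> ('i, 'j, 'u set, 'u \<Rightarrow> 'u) cfunctor \<Rightarrow> ('i \<Rightarrow> 'u \<Rightarrow> 'u) \<Rightarrow> 'u \<Rightarrow> ('i \<times> 'u) set"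
  where "cocone_fibre I G c y = {(i, x). i \<in> Obj I \<and> x \<in> fobj G i \<and> c i x = y}"

definition fibre_step ::
  "('i, 'j) category \<Rightarrow> ('i, 'j, 'u set, 'u \<Rightarrow> 'u) cfunctor \<Rightarrow> ('i \<Rightarrow> 'u \<Rightarrow> 'u) \<Rightarrow> 'u \<Rightarrow> ('i \<times> 'u) rel"
  where "fibre_step I G c y = {((i, x), (j, z)).
    (i, x) \<in> cocone_fibre I G c y \<and> (j, z) \<in> cocone_fibre I G c y \<and>
    ((\<exists>u\<in>Hom I i j. farr G i j u x = z) \<or> (\<exists>u\<in>Hom I j i. farr G j i u z = x))}"

text \<open>
  Nonemptiness of the fibres is joint surjectivity of the coprojections, hence uniqueness of
  mediating maps; connectedness says that the coprojections make no more identifications than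
  the arrows of the diagram force, so that a value chosen on each fibre does not depend on the
  choice, and mediating maps exist.
\<close>

lemma is_colimit_SET_iff_connected_fibres:
  fixes L :: "'u set"
  assumes inf: "infinite (UNIV :: 'u set)"
    and G: "is_functor I SET G"
    and cocone: "is_cocone I SET G L c"
  shows "is_colimit I SET G L c \<longleftrightarrow>
    (\<forall>y\<in>L. cocone_fibre I G c y \<noteq> {} \<and>
      (\<forall>p\<in>cocone_fibre I G c y. \<forall>q\<in>cocone_fibre I G c y. (p, q) \<in> (fibre_step I G c y)\<^sup>*))"
    (is "_ \<longleftrightarrow> ?connected")
proof -
  have G': "farr G i j u x \<in> fobj G j"
    if "i \<in> Obj I" "j \<in> Obj I" "u \<in> Hom I i j" "x \<in> fobj G i" for i j u x
    using G that by (auto simp: is_functor_def SET_def PiE_iff)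
  have c: "c i x \<in> L" if "i \<in> Obj I" "x \<in> fobj G i" for i x
    using cocone that unfolding is_cocone_SET_iff by blast
  have c_comp: "c j (farr G i j u x) = c i x"
    if "i \<in> Obj I" "j \<in> Obj I" "u \<in> Hom I i j" "x \<in> fobj G i" for i j u x
    using cocone that unfolding is_cocone_SET_iff by blast
  show ?thesis
  proof
    assume colim: "is_colimit I SET G L c"
    show ?connected
    proof (intro ballI conjI)
      fix y assume y: "y \<in> L"
      show "cocone_fibre I G c y \<noteq> {}"
      proof
        \<comment> \<open>If \<open>y\<close> is missed, removing it from \<open>L\<close> does not change the predicate that \<open>L\<close> induces.\<close>
        assume empty: "cocone_fibre I G c y = {}"
        have "\<exists>!S. S \<subseteq> L \<and> (\<forall>i\<in>Obj I. \<forall>x\<in>fobj G i. c i x \<in> S \<longleftrightarrow> True)"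
          by (rule colimit_SET_predicate[OF inf colim]) (auto intro: G')
        then obtain S
          where S: "\<forall>T. T \<subseteq> L \<and> (\<forall>i\<in>Obj I. \<forall>x\<in>fobj G i. c i x \<in> T \<longleftrightarrow> True) \<longrightarrow> T = S"
          by (rule ex1E) (rule that)
        have "L = S"
          using c by (intro S[rule_format]) auto
        moreover have "L - {y} = S"
          using c empty by (intro S[rule_format]) (auto simp: cocone_fibre_def)
        ultimately have "L = L - {y}" by simp
        with y show False by blast
      qed
    next
      fix y p q
      assume y: "y \<in> L" and p: "p \<in> cocone_fibre I G c y" and q: "q \<in> cocone_fibre I G c y"
      \<comment> \<open>Being in the component of \<open>p\<close> is a compatible predicate, so it only depends on the
        image in \<open>L\<close>, where \<open>p\<close> and \<open>q\<close> agree.\<close>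
      let ?P = "\<lambda>i x. (p, (i, x)) \<in> (fibre_step I G c y)\<^sup>*"
      have fib: "(i, x) \<in> cocone_fibre I G c y" if "?P i x" for i x
        using that p by (cases rule: rtranclE) (auto simp: fibre_step_def)
      have "\<exists>!S. S \<subseteq> L \<and> (\<forall>i\<in>Obj I. \<forall>x\<in>fobj G i. c i x \<in> S \<longleftrightarrow> ?P i x)"
      proof (rule colimit_SET_predicate[OF inf colim])
        fix i j u x
        assume ij: "i \<in> Obj I" "j \<in> Obj I" "u \<in> Hom I i j" "x \<in> fobj G i"
        have "((i, x), (j, farr G i j u x)) \<in> fibre_step I G c y \<and>
              ((j, farr G i j u x), (i, x)) \<in> fibre_step I G c y" if "c i x = y"
          using that ij G'[OF ij] c_comp[OF ij] by (auto simp: fibre_step_def cocone_fibre_def)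
        moreover have "c i x = y" if "?P i x \<or> ?P j (farr G i j u x)"
          using that fib c_comp[OF ij] by (auto simp: cocone_fibre_def)
        ultimately show "?P j (farr G i j u x) \<longleftrightarrow> ?P i x"
          by (meson rtrancl.rtrancl_into_rtrancl)
      qed (rule G')
      then obtain S where S: "S \<subseteq> L \<and> (\<forall>i\<in>Obj I. \<forall>x\<in>fobj G i. c i x \<in> S \<longleftrightarrow> ?P i x)"
        by (rule ex1E) (rule that)
      obtain i x j z where ij: "p = (i, x)" "q = (j, z)" by fastforce
      show "(p, q) \<in> (fibre_step I G c y)\<^sup>*"
      proof -
        have mem: "i \<in> Obj I" "x \<in> fobj G i" "j \<in> Obj I" "z \<in> fobj G j" "c i x = c j z"
          using p q ij by (simp_all add: cocone_fibre_def)
        have "c i x \<in> S"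
          using S mem(1,2) ij by simp
        then show ?thesis
          using S mem ij by simp
      qed
    qed
  next
    assume conn: ?connected
    show "is_colimit I SET G L c"
      unfolding is_colimit_SET_iff
    proof (intro conjI allI impI cocone)
      fix M :: "'u set" and d
      assume d: "is_cocone I SET G M d"
      have d_mem: "d i x \<in> M" if "i \<in> Obj I" "x \<in> fobj G i" for i x
        using d that unfolding is_cocone_SET_iff by blast
      have step: "d (fst p) (snd p) = d (fst q) (snd q)"
        if "(p, q) \<in> fibre_step I G c y" for p q y
        using that d unfolding is_cocone_SET_iff by (fastforce simp: fibre_step_def cocone_fibre_def)
      have steps: "d (fst p) (snd p) = d (fst q) (snd q)"
        if "(p, q) \<in> (fibre_step I G c y)\<^sup>*" for p q y
        using that by induction (auto dest: step)
      define pick where "pick = (\<lambda>y. SOME p. p \<in> cocone_fibre I G c y)"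
      have pick: "pick y \<in> cocone_fibre I G c y" if "y \<in> L" for y
        using conn that unfolding pick_def by (metis ex_in_conv someI_ex)
      define h where "h = (\<lambda>y\<in>L. d (fst (pick y)) (snd (pick y)))"
      have h_mem: "h \<in> L \<rightarrow>\<^sub>E M"
        using pick d_mem by (fastforce simp: h_def cocone_fibre_def)
      have h_c: "h (c i x) = d i x" if "i \<in> Obj I" "x \<in> fobj G i" for i x
      proof -
        have "(i, x) \<in> cocone_fibre I G c (c i x)"
          using that by (simp add: cocone_fibre_def)
        then have "(pick (c i x), (i, x)) \<in> (fibre_step I G c (c i x))\<^sup>*"
          using conn pick c that by blast
        from steps[OF this] show ?thesis
          using c that by (simp add: h_def)
      qed
      show "\<exists>!h. h \<in> L \<rightarrow>\<^sub>E M \<and> (\<forall>i\<in>Obj I. \<forall>x\<in>fobj G i. h (c i x) = d i x)"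
      proof (rule ex1I[of _ h])
        fix k assume k: "k \<in> L \<rightarrow>\<^sub>E M \<and> (\<forall>i\<in>Obj I. \<forall>x\<in>fobj G i. k (c i x) = d i x)"
        have "k y = h y" if "y \<in> L" for y
          using pick[OF that] k h_c by (auto simp: cocone_fibre_def split: prod.splits)
        then show "k = h"
          using k h_mem by (auto intro: PiE_ext)
      qed (use h_mem h_c in blast)
    qed
  qed
qed

section \<open>Diagrams in the category of elements\<close>

text \<open>
  An arrow of the category of elements is an arrow of \<open>C\<close>, so composing a functor with the
  projection to \<open>C\<close> leaves its arrow part as it is.
\<close>

definition elements_proj :: "('i, 'j, 'o \<times> 'u, 'u) cfunctor \<Rightarrow> ('i, 'j, 'o, 'u) cfunctor" where
  "elements_proj H = \<lparr>fobj = (\<lambda>j. fst (fobj H j)), farr = farr H\<rparr>"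

text \<open>
  For \<open>H j = (D j, x)\<close> this is the transformation \<open>Hom(D j, -) \<Rightarrow> F\<close> that corresponds to \<open>x\<close>
  under the Yoneda lemma.
\<close>

definition element_cocone ::
  "('o, 'u) category \<Rightarrow> ('o, 'u, 'u set, 'u \<Rightarrow> 'u) cfunctor \<Rightarrow> ('i, 'j, 'o \<times> 'u, 'u) cfunctor \<Rightarrow>
    'i \<Rightarrow> 'o \<Rightarrow> 'u \<Rightarrow> 'u"
  where "element_cocone C F H j A =
    (\<lambda>f\<in>Hom C (fst (fobj H j)) A. farr F (fst (fobj H j)) A f (snd (fobj H j)))"

lemma is_functor_elements_iff:
  "is_functor J (elements_cat C F) H \<longleftrightarrow> is_functor J C (elements_proj H) \<and>
    (\<forall>j\<in>Obj J. snd (fobj H j) \<in> fobj F (fst (fobj H j))) \<and>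
    (\<forall>i\<in>Obj J. \<forall>j\<in>Obj J. \<forall>u\<in>Hom J i j.
      farr F (fst (fobj H i)) (fst (fobj H j)) (farr H i j u) (snd (fobj H i)) = snd (fobj H j))"
  by (auto simp: is_functor_def elements_cat_def elements_proj_def case_prod_unfold)

lemma functor_SET_app:
  assumes "is_functor C SET F" "X \<in> Obj C" "Y \<in> Obj C" "f \<in> Hom C X Y" "x \<in> fobj F X"
  shows "farr F X Y f x \<in> fobj F Y"
  using assms by (auto simp: is_functor_def SET_def PiE_iff)

lemma functor_SET_comp:
  assumes "is_functor C SET F" "X \<in> Obj C" "Y \<in> Obj C" "Z \<in> Obj C"
    "f \<in> Hom C X Y" "g \<in> Hom C Y Z" "x \<in> fobj F X"
  shows "farr F X Z (Comp C X Y Z g f) x = farr F Y Z g (farr F X Y f x)"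
  using assms by (auto simp: is_functor_def SET_def compose_def)

context
  fixes C :: "('o, 'u) category"
    and F :: "('o, 'u, 'u set, 'u \<Rightarrow> 'u) cfunctor"
    and J :: "('i, 'j) category"
    and H :: "('i, 'j, 'o \<times> 'u, 'u) cfunctor"
  assumes cat: "is_category C"
    and F: "is_functor C SET F"
    and H: "is_functor J (elements_cat C F) H"
begin

lemma elements_functor_obj:
  assumes "j \<in> Obj J"
  shows "fst (fobj H j) \<in> Obj C" "snd (fobj H j) \<in> fobj F (fst (fobj H j))"
  using H assms by (auto simp: is_functor_def elements_cat_def case_prod_unfold)

lemma elements_functor_arr:
  assumes "i \<in> Obj J" "j \<in> Obj J" "u \<in> Hom J i j"
  shows "farr H i j u \<in> Hom C (fst (fobj H i)) (fst (fobj H j))"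
    "farr F (fst (fobj H i)) (fst (fobj H j)) (farr H i j u) (snd (fobj H i)) = snd (fobj H j)"
  using H assms by (auto simp: is_functor_def elements_cat_def case_prod_unfold)

lemma is_nat_trans_element_cocone:
  assumes "j \<in> Obj J"
  shows "is_nat_trans C SET (hom_functor C (fst (fobj H j))) F (element_cocone C F H j)"
proof -
  note o = elements_functor_obj[OF assms]
  have "Comp C (fst (fobj H j)) X Y g f \<in> Hom C (fst (fobj H j)) Y"
    if "X \<in> Obj C" "Y \<in> Obj C" "f \<in> Hom C (fst (fobj H j)) X" "g \<in> Hom C X Y" for X Y f g
    using that o cat unfolding is_category_def by blast
  then show ?thesis
    using o functor_SET_app[OF F] functor_SET_comp[OF F]
    by (auto simp: is_nat_trans_def SET_def hom_functor_def element_cocone_def compose_def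
        fun_eq_iff restrict_def)
qed

lemma is_cocone_element_cocone:
  assumes A: "A \<in> Obj C"
  shows "is_cocone (op_cat J) SET (rep_diagram C (elements_proj H) A) (fobj F A)
    (\<lambda>j. element_cocone C F H j A)"
  unfolding is_cocone_SET_iff
proof (intro conjI ballI)
  show "small TYPE('u) (fobj F A)"
    using F A by (auto simp: is_functor_def SET_def)
next
  fix j assume "j \<in> Obj (op_cat J)"
  then show "element_cocone C F H j A \<in> fobj (rep_diagram C (elements_proj H) A) j \<rightarrow>\<^sub>E fobj F A"
    using elements_functor_obj functor_SET_app[OF F] A
    by (auto simp: element_cocone_def rep_diagram_def elements_proj_def op_cat_def)
next
  fix i j u f
  assume *: "i \<in> Obj (op_cat J)" "j \<in> Obj (op_cat J)" "u \<in> Hom (op_cat J) i j"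
    "f \<in> fobj (rep_diagram C (elements_proj H) A) i"
  then have ij: "i \<in> Obj J" "j \<in> Obj J" "u \<in> Hom J j i" and f: "f \<in> Hom C (fst (fobj H i)) A"
    by (auto simp: op_cat_def rep_diagram_def elements_proj_def)
  note Hu = elements_functor_arr[OF ij(2,1,3)]
  have "Comp C (fst (fobj H j)) (fst (fobj H i)) A f (farr H j i u) \<in> Hom C (fst (fobj H j)) A"
    using cat Hu f ij A elements_functor_obj unfolding is_category_def by blast
  then show "element_cocone C F H j A (farr (rep_diagram C (elements_proj H) A) i j u f) =
      element_cocone C F H i A f"
    using functor_SET_comp[OF F _ _ A Hu(1) f] f Hu ij elements_functor_obj
    by (simp add: element_cocone_def rep_diagram_def elements_proj_def)
qed

text \<open>
  An arrow \<open>H j \<rightarrow> (A, y)\<close> is an arrow \<open>f : D j \<rightarrow> A\<close> that carries the element over \<open>j\<close> to \<open>y\<close>,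
  that is, a point of the fibre over \<open>y\<close> of the cocone on \<open>Hom(D j, A)\<close>.
\<close>

lemma Obj_comma_elements:
  assumes "A \<in> Obj C" "y \<in> fobj F A"
  shows "Obj (comma_cat J (elements_cat C F) H (A, y)) =
    cocone_fibre (op_cat J) (rep_diagram C (elements_proj H) A) (\<lambda>j. element_cocone C F H j A) y"
  by (auto simp: comma_cat_def cocone_fibre_def elements_cat_def op_cat_def rep_diagram_def
      elements_proj_def element_cocone_def case_prod_unfold)

lemma comma_step_elements:
  assumes "A \<in> Obj C" "y \<in> fobj F A"
  defines "K \<equiv> comma_cat J (elements_cat C F) H (A, y)"
  shows "{(p, q). p \<in> Obj K \<and> q \<in> Obj K \<and> (Hom K p q \<noteq> {} \<or> Hom K q p \<noteq> {})} =
    fibre_step (op_cat J) (rep_diagram C (elements_proj H) A) (\<lambda>j. element_cocone C F H j A) y"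
proof -
  let ?G = "rep_diagram C (elements_proj H) A"
  have obj: "Obj K = cocone_fibre (op_cat J) ?G (\<lambda>j. element_cocone C F H j A) y"
    unfolding K_def by (rule Obj_comma_elements[OF assms(1,2)])
  have hom: "Hom K (i, f) (j, g) \<noteq> {} \<longleftrightarrow> (\<exists>u\<in>Hom (op_cat J) j i. farr ?G j i u g = f)"
    if "(j, g) \<in> Obj K" for i f j g
    using that
    by (auto simp: K_def comma_cat_def op_cat_def elements_cat_def rep_diagram_def
        elements_proj_def case_prod_unfold)
  show ?thesis
  proof (rule set_eqI)
    fix e :: "('i \<times> 'u) \<times> 'i \<times> 'u"
    obtain i f j g where "e = ((i, f), (j, g))" by (metis surj_pair)
    then show "e \<in> {(p, q). p \<in> Obj K \<and> q \<in> Obj K \<and> (Hom K p q \<noteq> {} \<or> Hom K q p \<noteq> {})} \<longleftrightarrow>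
        e \<in> fibre_step (op_cat J) ?G (\<lambda>j. element_cocone C F H j A) y"
      unfolding fibre_step_def obj[symmetric] using hom[of j g i f] hom[of i f j g] by auto
  qed
qed

text \<open>
  The objects \<open>(A, y)\<close> of the category of elements are exactly the points of all the vertices
  \<open>F A\<close>, so the fibrewise criterion at every \<open>A\<close> together is cofinality of \<open>H\<close>.
\<close>

lemma pointwise_colimit_iff_cofinal:
  assumes inf: "infinite (UNIV :: 'u set)"
    and ls: "locally_small TYPE('u) C"
    and J: "is_category J"
  shows "is_pointwise_colimit_of_reps J C (elements_proj H) F (element_cocone C F H) \<longleftrightarrow>
    cofinal_functor J (elements_cat C F) H"
proof -
  have D: "is_functor J C (elements_proj H)"
    using H by (simp add: is_functor_elements_iff)
  have "is_colimit (op_cat J) SET (rep_diagram C (elements_proj H) A) (fobj F A)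
      (\<lambda>j. element_cocone C F H j A) \<longleftrightarrow>
    (\<forall>y\<in>fobj F A. Obj (comma_cat J (elements_cat C F) H (A, y)) \<noteq> {} \<and>
      connected_cat (comma_cat J (elements_cat C F) H (A, y)))" if A: "A \<in> Obj C" for A
    unfolding is_colimit_SET_iff_connected_fibres[OF inf
        is_functor_rep_diagram[OF J cat ls D A] is_cocone_element_cocone[OF A]]
    by (rule ball_cong, rule refl, simp only: connected_cat_def comma_step_elements[OF A])
      (simp only: Obj_comma_elements[OF A])
  moreover have "is_nat_trans C SET (hom_functor C (fobj (elements_proj H) j)) F
      (element_cocone C F H j)" if "j \<in> Obj J" for j
    using is_nat_trans_element_cocone[OF that] by (simp add: elements_proj_def)
  ultimately show ?thesis
    using H by (auto simp: is_pointwise_colimit_of_reps_def cofinal_functor_def elements_cat_def)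
qed

end

text \<open>
  The Yoneda lemma: coprojections \<open>c j : Hom(D j, -) \<Rightarrow> F\<close> are given by the elements
  \<open>c j (id) \<in> F (D j)\<close>, and compatibility of the coprojections says that these elements
  lift \<open>D\<close> to the category of elements.
\<close>

lemma pointwise_colimit_lift:
  fixes C :: "('o, 'u) category"
    and F :: "('o, 'u, 'u set, 'u \<Rightarrow> 'u) cfunctor"
    and J :: "('i, 'j) category"
    and D :: "('i, 'j, 'o, 'u) cfunctor"
  assumes cat: "is_category C"
    and F: "is_functor C SET F"
    and D: "is_functor J C D"
    and colim: "is_pointwise_colimit_of_reps J C D F c"
  obtains H where "is_functor J (elements_cat C F) H" "elements_proj H = D"
    "\<And>j A. j \<in> Obj J \<Longrightarrow> A \<in> Obj C \<Longrightarrow> element_cocone C F H j A = c j A"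
proof
  define H where "H = \<lparr>fobj = (\<lambda>j. (fobj D j, c j (fobj D j) (Id C (fobj D j)))), farr = farr D\<rparr>"
  have DO: "fobj D j \<in> Obj C" if "j \<in> Obj J" for j
    using D that by (auto simp: is_functor_def)
  have DA: "farr D i j u \<in> Hom C (fobj D i) (fobj D j)"
    if "i \<in> Obj J" "j \<in> Obj J" "u \<in> Hom J i j" for i j u
    using D that by (auto simp: is_functor_def)
  have id: "Id C X \<in> Hom C X X" if "X \<in> Obj C" for X
    using cat that by (auto simp: is_category_def)
  have nat: "is_nat_trans C SET (hom_functor C (fobj D j)) F (c j)" if "j \<in> Obj J" for j
    using colim that by (auto simp: is_pointwise_colimit_of_reps_def)
  have c: "c j A \<in> Hom C (fobj D j) A \<rightarrow>\<^sub>E fobj F A" if "j \<in> Obj J" "A \<in> Obj C" for j A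
    using nat[OF that(1)] that(2) by (auto simp: is_nat_trans_def SET_def hom_functor_def)
  have yoneda: "farr F (fobj D j) A f (c j (fobj D j) (Id C (fobj D j))) = c j A f"
    if "j \<in> Obj J" "A \<in> Obj C" "f \<in> Hom C (fobj D j) A" for j A f
  proof -
    let ?X = "fobj D j"
    have X: "?X \<in> Obj C" by (rule DO[OF that(1)])
    have "compose (Hom C ?X ?X) (c j A) (\<lambda>g\<in>Hom C ?X ?X. Comp C ?X ?X A f g) =
        compose (Hom C ?X ?X) (farr F ?X A f) (c j ?X)"
      using nat[OF that(1)] X that(2,3) by (simp add: is_nat_trans_def SET_def hom_functor_def)
    from fun_cong[OF this, of "Id C ?X"] have
      "c j A (Comp C ?X ?X A f (Id C ?X)) = farr F ?X A f (c j ?X (Id C ?X))"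
      using id[OF X] by (simp add: compose_def)
    moreover have "Comp C ?X ?X A f (Id C ?X) = f"
      using cat X that(2,3) unfolding is_category_def by blast
    ultimately show ?thesis by simp
  qed
  have c_comp: "c i A (Comp C (fobj D i) (fobj D j) A f (farr D i j u)) = c j A f"
    if "i \<in> Obj J" "j \<in> Obj J" "u \<in> Hom J i j" "A \<in> Obj C" "f \<in> Hom C (fobj D j) A" for i j u A f
  proof -
    have "is_cocone (op_cat J) SET (rep_diagram C D A) (fobj F A) (\<lambda>j. c j A)"
      using colim that(4) by (auto simp: is_pointwise_colimit_of_reps_def is_colimit_def)
    then show ?thesis
      using that by (simp add: is_cocone_SET_iff op_cat_def rep_diagram_def)
  qed
  have lift: "farr F (fobj D i) (fobj D j) (farr D i j u) (c i (fobj D i) (Id C (fobj D i))) =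
      c j (fobj D j) (Id C (fobj D j))" if "i \<in> Obj J" "j \<in> Obj J" "u \<in> Hom J i j" for i j u
  proof -
    have "Comp C (fobj D i) (fobj D j) (fobj D j) (Id C (fobj D j)) (farr D i j u) = farr D i j u"
      using cat DO[OF that(1)] DO[OF that(2)] DA[OF that] unfolding is_category_def by blast
    then show ?thesis
      using c_comp[OF that DO[OF that(2)] id[OF DO[OF that(2)]]]
        yoneda[OF that(1) DO[OF that(2)] DA[OF that]] by simp
  qed
  show proj: "elements_proj H = D"
    by (simp add: H_def elements_proj_def)
  have mem: "c j (fobj D j) (Id C (fobj D j)) \<in> fobj F (fobj D j)" if "j \<in> Obj J" for j
    using c[OF that DO[OF that]] id[OF DO[OF that]] by (rule PiE_mem)
  show "is_functor J (elements_cat C F) H"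
    using D mem lift unfolding is_functor_elements_iff proj by (simp add: H_def)
  show "element_cocone C F H j A = c j A" if "j \<in> Obj J" "A \<in> Obj C" for j A
  proof
    fix f
    show "element_cocone C F H j A f = c j A f"
      using yoneda[OF that, of f] PiE_arb[OF c[OF that], of f]
      by (simp add: element_cocone_def H_def restrict_def)
  qed
qed

lemma pointwise_colimit_cong:
  assumes "\<And>j A. j \<in> Obj J \<Longrightarrow> A \<in> Obj C \<Longrightarrow> c j A = c' j A"
  shows "is_pointwise_colimit_of_reps J C D F c \<longleftrightarrow> is_pointwise_colimit_of_reps J C D F c'"
  using assms
  by (simp add: is_pointwise_colimit_of_reps_def is_colimit_def is_cocone_def is_nat_trans_def
      op_cat_def)

section \<open>Small functors\<close>

theorem theorem1p10:
  fixes C :: "('o, 'u) category"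
    and F :: "('o, 'u, 'u set, 'u \<Rightarrow> 'u) cfunctor"
  assumes "infinite (UNIV :: 'u set)"
    and "is_category C"
    and "locally_small TYPE('u) C"
    and "is_functor C SET F"
  shows "small_functor C F \<longleftrightarrow>
    (\<exists>(J :: ('u, 'u) category) H.
       small_category TYPE('u) J \<and> cofinal_functor J (elements_cat C F) H)"
proof
  assume "small_functor C F"
  then obtain J :: "('u, 'u) category" and D c
    where J: "small_category TYPE('u) J" and D: "is_functor J C D"
      and colim: "is_pointwise_colimit_of_reps J C D F c"
    by (auto simp: small_functor_def)
  obtain H where H: "is_functor J (elements_cat C F) H" "elements_proj H = D"
    and c: "\<And>j A. j \<in> Obj J \<Longrightarrow> A \<in> Obj C \<Longrightarrow> element_cocone C F H j A = c j A"
    using pointwise_colimit_lift[OF assms(2,4) D colim] by blast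
  have "is_category J"
    using J by (simp add: small_category_def)
  moreover have "is_pointwise_colimit_of_reps J C (elements_proj H) F (element_cocone C F H)"
    using colim H(2) pointwise_colimit_cong[of J C "element_cocone C F H" c, OF c] by simp
  ultimately have "cofinal_functor J (elements_cat C F) H"
    using pointwise_colimit_iff_cofinal[OF assms(2,4) H(1) assms(1,3)] by blast
  with J show "\<exists>(J :: ('u, 'u) category) H.
      small_category TYPE('u) J \<and> cofinal_functor J (elements_cat C F) H" by blast
next
  assume "\<exists>(J :: ('u, 'u) category) H.
    small_category TYPE('u) J \<and> cofinal_functor J (elements_cat C F) H"
  then obtain J :: "('u, 'u) category" and H
    where J: "small_category TYPE('u) J" and cofinal: "cofinal_functor J (elements_cat C F) H"
    by blast
  have H: "is_functor J (elements_cat C F) H"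
    using cofinal by (simp add: cofinal_functor_def)
  have "is_category J"
    using J by (simp add: small_category_def)
  then have "is_pointwise_colimit_of_reps J C (elements_proj H) F (element_cocone C F H)"
    using pointwise_colimit_iff_cofinal[OF assms(2,4) H assms(1,3)] cofinal by blast
  moreover have "is_functor J C (elements_proj H)"
    using H by (simp add: is_functor_elements_iff)
  ultimately show "small_functor C F"
    using J unfolding small_functor_def by blast
qed

end
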